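(* For every integer $n\ge 1$ and all real numbers $x,y$, $$D_{n}^{(c)}(x,y)-nD_{n-1}^{(c)}(x,y)=\sum_{m=0}^{[\frac{n}{2}]}\binom{n}{2m}(-1)^{m}(x-1)^{n-2m}y^{2m}.$$
   Context: The cosine-derangement polynomials $D_n^{(c)}(x,y)$, $n\ge 0$, are defined by the generating function (power series in $t$) $\displaystyle\frac{e^{-t}}{1-t}e^{xt}\cos(yt)=\sum_{n=0}^{\infty}D_{n}^{(c)}(x,y)\frac{t^{n}}{n!}$. $[a]$ denotes the greatest integer not exceeding $a$. Convention: $0^0=1$. *)

theory Defs
  imports Complex_Main "HOL-Computational_Algebra.Formal_Power_Series"
begin

definition cos_derangement_gf :: "real \<Rightarrow> real \<Rightarrow> real fps" where
  "cos_derangement_gf x y = fps_exp (-1) / (1 - fps_X) * fps_exp x * fps_cos y"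

definition cos_derangement :: "nat \<Rightarrow> real \<Rightarrow> real \<Rightarrow> real" where
  "cos_derangement n x y = fact n * fps_nth (cos_derangement_gf x y) n"

lemma cos_derangement_egf:
  "cos_derangement_gf x y = Abs_fps (\<lambda>n. cos_derangement n x y / fact n)"
  by (simp add: fps_eq_iff cos_derangement_def)

end

theory Submission
  imports Defs
begin

text \<open>
  Multiplying an exponential generating function \<open>\<Sum> a\<^sub>n t\<^sup>n / n!\<close> by \<open>1 - t\<close> replaces \<open>a\<^sub>n\<close> by
  \<open>a\<^sub>n - n a\<^sub>n\<^sub>-\<^sub>1\<close>. For the cosine-derangement polynomials this operation cancels the denominator
  and leaves \<open>e\<^bsup>(x-1)t\<^esup> cos (y t)\<close>, so the left-hand side of the theorem is \<open>n!\<close> times the \<open>n\<close>-th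
  coefficient of that product. Only the even powers of \<open>t\<close> contribute to the cosine, and the
  Cauchy product with the exponential series therefore gives the sum on the right.
\<close>

lemma sum_even_atMost:
  fixes f :: "nat \<Rightarrow> 'a::comm_monoid_add"
  shows "(\<Sum>i = 0..n. if even i then f i else 0) = (\<Sum>m = 0..n div 2. f (2 * m))"
proof -
  have "(\<Sum>i = 0..n. if even i then f i else 0) = sum f {i \<in> {0..n}. even i}"
    by (rule sum.inter_filter [symmetric]) simp
  also have "\<dots> = (\<Sum>m = 0..n div 2. f (2 * m))"
    by (rule sum.reindex_bij_witness[where i = "\<lambda>m. 2 * m" and j = "\<lambda>i. i div 2"]) auto
  finally show ?thesis .
qed

lemma fact_mult_fps_exp_cos_nth:
  fixes a b :: "'a::field_char_0"
  shows "fact n * fps_nth (fps_exp a * fps_cos b) n =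
    (\<Sum>m = 0..n div 2. of_nat (n choose (2 * m)) * (-1) ^ m * a ^ (n - 2 * m) * b ^ (2 * m))"
proof -
  have "fact n * fps_nth (fps_cos b * fps_exp a) n =
      (\<Sum>i = 0..n. if even i
        then fact n * ((-1) ^ (i div 2) * b ^ i / fact i * (a ^ (n - i) / fact (n - i))) else 0)"
    unfolding fps_mult_nth sum_distrib_left
    by (intro sum.cong) (auto simp: fps_cos_def)
  also have "\<dots> = (\<Sum>m = 0..n div 2. fact n *
      ((-1) ^ m * b ^ (2 * m) / fact (2 * m) * (a ^ (n - 2 * m) / fact (n - 2 * m))))"
    by (simp add: sum_even_atMost)
  also have "\<dots> =
      (\<Sum>m = 0..n div 2. of_nat (n choose (2 * m)) * (-1) ^ m * a ^ (n - 2 * m) * b ^ (2 * m))"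
    by (intro sum.cong refl) (simp add: binomial_fact)
  finally show ?thesis
    by (simp add: mult.commute)
qed

lemma one_minus_X_times_cos_derangement_gf:
  "(1 - fps_X) * cos_derangement_gf x y = fps_exp (x - 1) * fps_cos y"
proof -
  have "(1 - fps_X) * (fps_exp (-1) / (1 - fps_X)) = (fps_exp (-1) :: real fps)"
    by (simp add: fps_divide_unit mult.left_commute inverse_mult_eq_1')
  then have "(1 - fps_X) * cos_derangement_gf x y = fps_exp (-1) * fps_exp x * fps_cos y"
    unfolding cos_derangement_gf_def by (simp only: mult.assoc [symmetric])
  also have "fps_exp (-1) * fps_exp x = fps_exp (x - 1)"
    by (simp flip: fps_exp_add_mult)
  finally show ?thesis .
qed

theorem theorem10:
  fixes n :: nat and x y :: real
  assumes "n \<ge> 1"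
  shows "cos_derangement n x y - real n * cos_derangement (n - 1) x y =
    (\<Sum>m = 0..n div 2. real (n choose (2 * m)) * (-1) ^ m * (x - 1) ^ (n - 2 * m) * y ^ (2 * m))"
proof -
  have "fact n = real n * fact (n - 1)"
    using assms by (simp add: fact_reduce)
  then have "cos_derangement n x y - real n * cos_derangement (n - 1) x y =
      fact n * fps_nth ((1 - fps_X) * cos_derangement_gf x y) n"
    using assms by (simp add: cos_derangement_def left_diff_distrib right_diff_distrib)
  also have "\<dots> = fact n * fps_nth (fps_exp (x - 1) * fps_cos y) n"
    by (simp only: one_minus_X_times_cos_derangement_gf)
  finally show ?thesis
    by (simp add: fact_mult_fps_exp_cos_nth)
qed

end
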